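(* Let $q=(a_1,\dots,a_n)$, $n\ge1$, be the quiddity sequence of an infinite periodic frieze with entries $a_{i,j}$, and let $s_q=a_{1,n}-a_{2,n-1}$ be its growth coefficient. Then \[ s_q=\left(\sum_{I}(-1)^{\ell_I}\prod_{k\in I}a_k\right)+\delta_n, \] where the sum runs over all cyclic pair-excluding subsets $I\subseteq\{1,\dots,n\}$, $\ell_I=\frac{n-|I|}{2}$ is the number of pairs removed to obtain $I$, and $\delta_n=0$ if $n$ is odd, $\delta_n=1$ if $n$ is divisible by $4$, and $\delta_n=-1$ otherwise.
   Context: Friezes: given a sequence $(a_i)_{i\in\mathbb{Z}}$ of positive integers, define $a_{i,j}$ for $j\ge i-2$ by $a_{i,i-2}=0$, $a_{i,i-1}=1$, $a_{i,i}=a_i$ and the diamond rule $a_{i,j}a_{i+1,j+1}-a_{i,j+1}a_{i+1,j}=1$. This is an infinite frieze if all $a_{i,j}$ ($j\ge i$) are positive integers; it is periodic with quiddity sequence $(a_1,\dots,a_n)$ if $a_{i+n}=a_i$ for all $i$, and then the entries $a_{i,j}$ are indexed with $a_i$ taken periodically. A cyclic pair-excluding subset of $\{1,\dots,n\}$ is a subset obtained by removing zero or more disjoint pairs of consecutive elements, where $n$ and $1$ are also considered consecutive. Empty products equal $1$. *)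

theory Defs
  imports Main
begin

text \<open>
  \<open>m i j\<close> is the frieze entry $a_{i,j}$, meaningful for \<open>j \<ge> i - 2\<close> only; values of \<open>m\<close> outside
  this range are unconstrained. Since the entries with \<open>j \<ge> i\<close> are nonzero, \<open>m\<close> is determined on
  its range by \<open>a\<close>. The diamond rule is imposed exactly where all four of its entries are in
  range, namely for \<open>j \<ge> i - 1\<close>.
\<close>

definition infinite_frieze :: "(int \<Rightarrow> int) \<Rightarrow> (int \<Rightarrow> int \<Rightarrow> int) \<Rightarrow> bool" where
  "infinite_frieze a m \<longleftrightarrow>
     (\<forall>i. a i > 0) \<and>
     (\<forall>i. m i (i - 2) = 0) \<and>
     (\<forall>i. m i (i - 1) = 1) \<and>
     (\<forall>i. m i i = a i) \<and>
     (\<forall>i j. j \<ge> i - 1 \<longrightarrow> m i j * m (i + 1) (j + 1) - m i (j + 1) * m (i + 1) j = 1) \<and>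
     (\<forall>i j. j \<ge> i \<longrightarrow> m i j > 0)"

text \<open>The frieze has quiddity sequence \<open>(a 1, \<dots>, a n)\<close>; \<open>n\<close> need not be the minimal period.\<close>

definition periodic_infinite_frieze ::
    "nat \<Rightarrow> (int \<Rightarrow> int) \<Rightarrow> (int \<Rightarrow> int \<Rightarrow> int) \<Rightarrow> bool" where
  "periodic_infinite_frieze n a m \<longleftrightarrow> infinite_frieze a m \<and> (\<forall>i. a (i + int n) = a i)"

definition growth_coefficient :: "nat \<Rightarrow> (int \<Rightarrow> int \<Rightarrow> int) \<Rightarrow> int" where
  "growth_coefficient n m = m 1 (int n) - m 2 (int n - 1)"

text \<open>
  Pairs are two-element sets: for \<open>n = 1\<close> there are none (\<open>1\<close> is not paired with itself), and for
  \<open>n = 2\<close> the only pair is \<open>{1, 2}\<close>.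
\<close>

definition cyclic_consecutive_pairs :: "nat \<Rightarrow> nat set set" where
  "cyclic_consecutive_pairs n =
     {{k, k + 1} | k. 1 \<le> k \<and> k < n} \<union> (if n \<ge> 2 then {{n, 1}} else {})"

definition cyclic_pair_excluding :: "nat \<Rightarrow> nat set \<Rightarrow> bool" where
  "cyclic_pair_excluding n I \<longleftrightarrow>
     (\<exists>P. P \<subseteq> cyclic_consecutive_pairs n \<and> pairwise disjnt P \<and> I = {1..n} - \<Union>P)"

lemma finite_cyclic_pair_excluding: "finite {I. cyclic_pair_excluding n I}"
  by (rule finite_subset[of _ "Pow {1..n}"]) (auto simp: cyclic_pair_excluding_def)

text \<open>
  For a cyclic pair-excluding \<open>I\<close> the difference \<open>n - card I\<close> is nonnegative and even, so neither
  the truncated subtraction nor \<open>div\<close> loses information.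
\<close>

definition removed_pairs :: "nat \<Rightarrow> nat set \<Rightarrow> nat" where
  "removed_pairs n I = (n - card I) div 2"

definition delta :: "nat \<Rightarrow> int" where
  "delta n = (if odd n then 0 else if 4 dvd n then 1 else - 1)"

end

theory Submission
  imports Defs
begin

text \<open>
  The diamond rule forces the continuant recurrence
  $a_{i,j} = a_j a_{i,j-1} - a_{i,j-2}$, so $a_{i,j}$ is the signed sum over the subsets of
  $\{i,\dots,j\}$ obtained by removing disjoint pairs of linearly consecutive elements. A cyclic
  pair-excluding subset of $\{1,\dots,n\}$ arises either without removing $\{n,1\}$, which
  contributes to $a_{1,n}$, or by removing it, which contributes to $-a_{2,n-1}$. The least
  element of a nonempty subset has a parity that tells the two cases apart, so only the empty set,
  for even $n$, arises in both ways; $\delta_n$ accounts for it.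
\<close>

section \<open>Removing disjoint members of a set system\<close>

definition excluding :: "'a set \<Rightarrow> 'a set set \<Rightarrow> 'a set set" where
  "excluding A Q = {A - \<Union>P | P. P \<subseteq> Q \<and> pairwise disjnt P}"

lemma excluding_empty [simp]: "excluding A {} = {A}"
  by (auto simp: excluding_def)

text \<open>Split on whether \<open>p\<close> is removed: if it is, every other removed set is
  disjoint from \<open>p\<close>, and the removal continues in \<open>A - p\<close>. This drives
  both the linear recursion and the cyclic decomposition.\<close>

lemma excluding_insert:
  "excluding A (insert p Q) = excluding A Q \<union> excluding (A - p) {q \<in> Q. disjnt q p}"
proof (intro equalityI subsetI)
  fix I assume "I \<in> excluding A (insert p Q)"
  then obtain P where P: "P \<subseteq> insert p Q" "pairwise disjnt P" "I = A - \<Union>P"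
    by (auto simp: excluding_def)
  show "I \<in> excluding A Q \<union> excluding (A - p) {q \<in> Q. disjnt q p}"
  proof (cases "p \<in> P")
    case True
    have "P - {p} \<subseteq> {q \<in> Q. disjnt q p}"
      using P True by (auto simp: pairwise_def)
    moreover have "pairwise disjnt (P - {p})"
      using P(2) by (rule pairwise_subset) auto
    moreover have "I = (A - p) - \<Union>(P - {p})"
      using P True by auto
    ultimately show ?thesis
      by (auto simp: excluding_def)
  next
    case False
    then show ?thesis
      using P by (auto simp: excluding_def)
  qed
next
  fix I assume "I \<in> excluding A Q \<union> excluding (A - p) {q \<in> Q. disjnt q p}"
  then show "I \<in> excluding A (insert p Q)"
  proof
    assume "I \<in> excluding A Q"
    then show ?thesis
      by (auto simp: excluding_def)
  next
    assume "I \<in> excluding (A - p) {q \<in> Q. disjnt q p}"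
    then obtain P where P: "P \<subseteq> {q \<in> Q. disjnt q p}" "pairwise disjnt P" "I = (A - p) - \<Union>P"
      by (auto simp: excluding_def)
    have "insert p P \<subseteq> insert p Q" "I = A - \<Union>(insert p P)"
      using P by auto
    moreover have "pairwise disjnt (insert p P)"
      using P by (auto simp: pairwise_insert disjnt_sym)
    ultimately show ?thesis
      unfolding excluding_def by blast
  qed
qed

lemma excluding_insert_element:
  assumes "x \<notin> \<Union>Q"
  shows "excluding (insert x A) Q = insert x ` excluding A Q"
proof -
  have "insert x A - \<Union>P = insert x (A - \<Union>P)" if "P \<subseteq> Q" for P
    using assms that by auto
  then show ?thesis
    unfolding excluding_def setcompr_eq_image image_image by (intro image_cong) auto
qed

section \<open>Pair-excluding subsets of an interval\<close>

definition consecutive_pairs :: "nat \<Rightarrow> nat \<Rightarrow> nat set set" where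
  "consecutive_pairs i n = {{k, k + 1} | k. i \<le> k \<and> k + 1 < i + n}"

definition linear_excluding :: "nat \<Rightarrow> nat \<Rightarrow> nat set set" where
  "linear_excluding i n = excluding {i..<i + n} (consecutive_pairs i n)"

lemma consecutive_pairs_0 [simp]: "consecutive_pairs i 0 = {}"
  and consecutive_pairs_1 [simp]: "consecutive_pairs i (Suc 0) = {}"
  by (auto simp: consecutive_pairs_def)

lemma consecutive_pairs_Suc_Suc:
  "consecutive_pairs i (Suc (Suc n)) = insert {i + n, i + n + 1} (consecutive_pairs i (Suc n))"
proof -
  have "i \<le> k \<and> k + 1 < i + Suc (Suc n) \<longleftrightarrow> k = i + n \<or> i \<le> k \<and> k + 1 < i + Suc n" for k
    by auto
  then show ?thesis
    unfolding consecutive_pairs_def by auto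
qed

lemma linear_excluding_0 [simp]: "linear_excluding i 0 = {{}}"
  and linear_excluding_1 [simp]: "linear_excluding i (Suc 0) = {{i}}"
  by (auto simp: linear_excluding_def)

text \<open>Split on the last pair. If it stays, no other pair contains the last element, which
  therefore survives; if it goes, an interval of length \<open>n\<close> remains.\<close>

lemma linear_excluding_Suc_Suc:
  "linear_excluding i (Suc (Suc n)) =
     insert (i + n + 1) ` linear_excluding i (Suc n) \<union> linear_excluding i n"
proof -
  have "{q \<in> consecutive_pairs i (Suc n). disjnt q {i + n, i + n + 1}} = consecutive_pairs i n"
    by (auto simp: consecutive_pairs_def disjnt_def)
  moreover have "{i..<i + Suc (Suc n)} - {i + n, i + n + 1} = {i..<i + n}"
    by auto
  moreover have "{i..<i + Suc (Suc n)} = insert (i + n + 1) {i..<i + Suc n}"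
    by auto
  moreover have "i + n + 1 \<notin> \<Union>(consecutive_pairs i (Suc n))"
    by (auto simp: consecutive_pairs_def)
  ultimately show ?thesis
    by (simp only: linear_excluding_def consecutive_pairs_Suc_Suc excluding_insert
        excluding_insert_element not_False_eq_True)
qed

lemma linear_excluding_subset: "I \<in> linear_excluding i n \<Longrightarrow> I \<subseteq> {i..<i + n}"
  by (auto simp: linear_excluding_def excluding_def)

lemma finite_linear_excluding: "finite (linear_excluding i n)"
  by (rule finite_subset[of _ "Pow {i..<i + n}"]) (auto dest: linear_excluding_subset)

lemma empty_in_linear_excluding: "{} \<in> linear_excluding i n \<longleftrightarrow> even n"
  by (induction n rule: induct_nat_012) (auto simp: linear_excluding_Suc_Suc)

text \<open>No removed pair straddles the least survivor, so the elements before it are tiled by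
  removed pairs. The induction works from the other end, where inserting a last element moves the
  minimum only if nothing else survives.\<close>

lemma even_first_linear_excluding:
  assumes "I \<in> linear_excluding i n" "I \<noteq> {}"
  shows "even (Min I - i)"
  using assms
proof (induction n arbitrary: I rule: less_induct)
  case (less n)
  consider "n = 0" | "n = Suc 0" | l where "n = Suc (Suc l)"
    by (metis not0_implies_Suc)
  then show ?case
  proof cases
    case 3
    then consider (remove) "I \<in> linear_excluding i l"
      | (insert) J where "J \<in> linear_excluding i (Suc l)" "I = insert (i + l + 1) J"
      using less.prems(1) by (auto simp: linear_excluding_Suc_Suc)
    then show ?thesis
    proof cases
      case remove
      then show ?thesis
        using less.IH[of l I] less.prems(2) 3 by simp
    next
      case insert
      have J: "J \<subseteq> {i..<i + Suc l}"
        using insert(1) by (rule linear_excluding_subset)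
      show ?thesis
      proof (cases "J = {}")
        \<comment> \<open>The minimum is now \<open>i + l + 1\<close>, and \<open>J = {}\<close>
          forces \<open>Suc l\<close> to be even.\<close>
        case True
        then show ?thesis
          using insert by (auto simp: empty_in_linear_excluding)
      next
        case False
        have "finite J"
          using J finite_subset by blast
        moreover from this have "Min J \<in> {i..<i + Suc l}"
          using J False Min_in by blast
        ultimately have "Min I = Min J"
          using False insert(2) by simp
        then show ?thesis
          using less.IH[of "Suc l" J] insert(1) False 3 by simp
      qed
    qed
  qed (use less.prems in auto)
qed

section \<open>Signed sums and continuants\<close>

definition excluding_weight :: "(int \<Rightarrow> int) \<Rightarrow> nat \<Rightarrow> nat set \<Rightarrow> int" where
  "excluding_weight a n I = (- 1) ^ removed_pairs n I * (\<Prod>k\<in>I. a (int k))"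

lemma excluding_weight_insert:
  assumes "finite I" "x \<notin> I"
  shows "excluding_weight a (Suc n) (insert x I) = a (int x) * excluding_weight a n I"
  using assms by (simp add: excluding_weight_def removed_pairs_def)

text \<open>Two more elements with the same survivors mean one more removed pair. The bound
  \<open>card I \<le> n\<close> keeps the truncated subtraction exact.\<close>

lemma excluding_weight_Suc_Suc:
  assumes "I \<in> linear_excluding i n"
  shows "excluding_weight a (Suc (Suc n)) I = - excluding_weight a n I"
proof -
  have "card I \<le> n"
    using card_mono[OF _ linear_excluding_subset[OF assms]] by simp
  then have "(Suc (Suc n) - card I) div 2 = Suc ((n - card I) div 2)"
    by (simp add: Suc_diff_le)
  then show ?thesis
    by (simp add: excluding_weight_def removed_pairs_def)
qed

text \<open>Euler's rule for the determinant of the tridiagonal matrix with diagonal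
  \<open>a i, ..., a (i + n - 1)\<close> and ones beside the diagonal.\<close>

definition continuant :: "(int \<Rightarrow> int) \<Rightarrow> nat \<Rightarrow> nat \<Rightarrow> int" where
  "continuant a i n = (\<Sum>I\<in>linear_excluding i n. excluding_weight a n I)"

lemma continuant_0 [simp]: "continuant a i 0 = 1"
  and continuant_1 [simp]: "continuant a i (Suc 0) = a (int i)"
  by (simp_all add: continuant_def excluding_weight_def removed_pairs_def)

lemma continuant_Suc_Suc:
  "continuant a i (Suc (Suc n)) =
     a (int (i + n + 1)) * continuant a i (Suc n) - continuant a i n"
proof -
  let ?x = "i + n + 1"
  have x: "?x \<notin> I" "finite I" if "I \<in> linear_excluding i (Suc n)" for I
    using linear_excluding_subset[OF that] finite_subset by auto
  have x': "?x \<notin> I" if "I \<in> linear_excluding i n" for I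
    using linear_excluding_subset[OF that] by auto
  have inj: "inj_on (insert ?x) (linear_excluding i (Suc n))"
    using x(1) by (auto simp: inj_on_def insert_ident)
  \<comment> \<open>The two families are disjoint, since only the first has members containing
    \<open>?x\<close>.\<close>
  have "continuant a i (Suc (Suc n)) =
      (\<Sum>I\<in>insert ?x ` linear_excluding i (Suc n). excluding_weight a (Suc (Suc n)) I)
      + (\<Sum>I\<in>linear_excluding i n. excluding_weight a (Suc (Suc n)) I)"
    unfolding continuant_def linear_excluding_Suc_Suc
    by (rule sum.union_disjoint) (use x' finite_linear_excluding in auto)
  also have "(\<Sum>I\<in>insert ?x ` linear_excluding i (Suc n). excluding_weight a (Suc (Suc n)) I)
      = a (int ?x) * continuant a i (Suc n)"
    unfolding sum.reindex[OF inj] continuant_def sum_distrib_left o_def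
    by (intro sum.cong refl excluding_weight_insert x)
  also have "(\<Sum>I\<in>linear_excluding i n. excluding_weight a (Suc (Suc n)) I)
      = - continuant a i n"
    by (simp add: continuant_def sum_negf excluding_weight_Suc_Suc cong: sum.cong)
  finally show ?thesis
    by simp
qed

section \<open>Frieze entries as continuants\<close>

text \<open>Equate the diamond rules at \<open>j\<close> and \<open>j - 1\<close> and substitute the
  recurrence for row \<open>i + 1\<close>: the claim appears multiplied by
  \<open>m (i + 1) j\<close>, which is nonzero.\<close>

lemma frieze_recurrence:
  assumes "infinite_frieze a m"
  shows "m i (i + int n) = a (i + int n) * m i (i + int n - 1) - m i (i + int n - 2)"
proof (induction n arbitrary: i)
  case 0
  then show ?case
    using assms by (simp add: infinite_frieze_def)
next
  case (Suc n)
  define j where "j = i + int n"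
  have IH: "m (i + 1) (j + 1) = a (j + 1) * m (i + 1) j - m (i + 1) (j - 1)"
    using Suc.IH[of "i + 1"] by (simp add: j_def algebra_simps)
  have diamond: "m i k * m (i + 1) (k + 1) - m i (k + 1) * m (i + 1) k = 1" if "k \<ge> i - 1" for k
    using assms that by (simp add: infinite_frieze_def)
  have "m i j * m (i + 1) (j + 1) - m i (j + 1) * m (i + 1) j
      = m i (j - 1) * m (i + 1) j - m i j * m (i + 1) (j - 1)"
    using diamond[of j] diamond[of "j - 1"] by (simp add: j_def)
  then have "m (i + 1) j * (m i (j + 1) - (a (j + 1) * m i j - m i (j - 1))) = 0"
    unfolding IH by algebra
  moreover have "m (i + 1) j \<noteq> 0"
  \<comment> \<open>For \<open>n = 0\<close> this entry lies on the boundary of ones, outside the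
    range of the positivity condition.\<close>
  proof (cases n)
    case 0
    have "m (i + 1) (i + 1 - 1) = 1"
      using assms unfolding infinite_frieze_def by blast
    then show ?thesis
      by (simp add: j_def 0)
  next
    case (Suc l)
    then have "m (i + 1) j > 0"
      using assms by (simp add: infinite_frieze_def j_def)
    then show ?thesis
      by simp
  qed
  ultimately have "m i (j + 1) = a (j + 1) * m i j - m i (j - 1)"
    by simp
  moreover have "i + int (Suc n) = j + 1" "j + 1 - 1 = j" "j + 1 - 2 = j - 1"
    by (simp_all add: j_def)
  ultimately show ?case
    by (simp only:)
qed

text \<open>Both sides satisfy the same three-term recurrence and agree on the row of ones
  (\<open>n = 0\<close>) and the quiddity row (\<open>n = 1\<close>).\<close>

lemma frieze_eq_continuant:
  assumes "infinite_frieze a m"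
  shows "m (int i) (int i + int n - 1) = continuant a i n"
proof (induction n rule: induct_nat_012)
  case (ge2 n)
  have "int i + int (Suc (Suc n)) - 1 = int i + int (Suc n)"
    "int i + int (Suc n) - 2 = int i + int n - 1" "int (i + n + 1) = int i + int (Suc n)"
    by simp_all
  then show ?case
    using frieze_recurrence[OF assms, of "int i" "Suc n"] ge2
    by (simp only: continuant_Suc_Suc)
qed (use assms in \<open>simp_all add: infinite_frieze_def\<close>)

section \<open>Cyclic subsets and the growth coefficient\<close>

lemma cyclic_pair_excluding_1: "{I. cyclic_pair_excluding (Suc 0) I} = linear_excluding 1 (Suc 0)"
  by (auto simp: cyclic_pair_excluding_def cyclic_consecutive_pairs_def)

text \<open>Split on whether the wrap-around pair is removed. For \<open>n = 0\<close> that pair is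
  \<open>{1, 2}\<close> itself, already a linear pair, and the identity still holds.\<close>

lemma cyclic_pair_excluding_Suc_Suc:
  "{I. cyclic_pair_excluding (Suc (Suc n)) I} =
     linear_excluding 1 (Suc (Suc n)) \<union> linear_excluding 2 n"
proof -
  let ?n = "Suc (Suc n)"
  have "cyclic_consecutive_pairs ?n = insert {?n, 1} (consecutive_pairs 1 ?n)"
    by (simp add: cyclic_consecutive_pairs_def consecutive_pairs_def)
  moreover have "{q \<in> consecutive_pairs 1 ?n. disjnt q {?n, 1}} = consecutive_pairs 2 n"
    by (force simp: consecutive_pairs_def disjnt_def)
  moreover have "{1..?n} - {?n, 1} = {2..<2 + n}" "{1..?n} = {1..<1 + ?n}"
    by auto
  moreover have "{I. cyclic_pair_excluding ?n I}
      = excluding {1..?n} (cyclic_consecutive_pairs ?n)"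
    by (auto simp: cyclic_pair_excluding_def excluding_def)
  ultimately show ?thesis
    by (simp only: linear_excluding_def excluding_insert)
qed

lemma linear_excluding_1_Int_2:
  "linear_excluding 1 (Suc (Suc n)) \<inter> linear_excluding 2 n = (if even n then {{}} else {})"
proof -
  have "I = {}" if I: "I \<in> linear_excluding 1 (Suc (Suc n))" "I \<in> linear_excluding 2 n" for I
  proof (rule ccontr)
    assume "I \<noteq> {}"
    then have "even (Min I - 1)" "even (Min I - 2)"
      using I even_first_linear_excluding by blast+
    \<comment> \<open>This rules out \<open>Min I = 1\<close>, where both truncated differences
      would be 0 and give no contradiction.\<close>
    moreover have "Min I \<ge> 2"
      using linear_excluding_subset[OF I(2)] \<open>I \<noteq> {}\<close>
      by (meson Min_in atLeastLessThan_iff finite_atLeastLessThan finite_subset subsetD)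
    ultimately show False
      by simp
  qed
  moreover have "{} \<in> linear_excluding 1 (Suc (Suc n)) \<longleftrightarrow> even n"
      "{} \<in> linear_excluding 2 n \<longleftrightarrow> even n"
    by (simp_all add: empty_in_linear_excluding)
  ultimately show ?thesis
    by (cases "even n") (simp_all, blast+)
qed

text \<open>For even \<open>n\<close> this is the weight of the empty set, reached by removing
  \<open>n div 2\<close> pairs.\<close>

lemma delta_eq: "delta n = (if even n then (- 1) ^ (n div 2) else 0)"
  by (auto simp: delta_def elim!: evenE)

theorem theoremB:
  fixes a :: "int \<Rightarrow> int" and m :: "int \<Rightarrow> int \<Rightarrow> int" and n :: nat
  assumes "n \<ge> 1"
    and "periodic_infinite_frieze n a m"
  shows "growth_coefficient n m =
    (\<Sum>I\<in>{I. cyclic_pair_excluding n I}. (- 1) ^ removed_pairs n I * (\<Prod>k\<in>I. a (int k)))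
      + delta n"
proof -
  have frieze: "infinite_frieze a m"
    using assms(2) by (simp add: periodic_infinite_frieze_def)
  note entry = frieze_eq_continuant[OF frieze]
  consider "n = Suc 0" | l where "n = Suc (Suc l)"
    using assms(1) by (metis not0_implies_Suc not_one_le_zero)
  then have "growth_coefficient n m =
      (\<Sum>I\<in>{I. cyclic_pair_excluding n I}. excluding_weight a n I) + delta n"
  proof cases
    case 1
    \<comment> \<open>For \<open>n = 1\<close> the subtracted entry lies in the row of zeros, which
      \<open>frieze_eq_continuant\<close> does not reach.\<close>
    have "m 2 0 = 0"
      using frieze by (metis infinite_frieze_def diff_self)
    then show ?thesis
      using entry[of 1 1] unfolding 1 cyclic_pair_excluding_1
      by (simp add: growth_coefficient_def delta_def continuant_def)
  next
    case 2
    have "growth_coefficient n m = continuant a 1 n - continuant a 2 l"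
      using entry[of 1 n] entry[of 2 l] by (simp add: growth_coefficient_def 2)
    \<comment> \<open>Weighing the second family with \<open>n = l + 2\<close> in place of
      \<open>l\<close> counts the wrap-around pair and absorbs the minus sign.\<close>
    also have "\<dots> = (\<Sum>I\<in>linear_excluding 1 n. excluding_weight a n I)
        + (\<Sum>I\<in>linear_excluding 2 l. excluding_weight a n I)"
      by (simp add: continuant_def 2 excluding_weight_Suc_Suc sum_negf cong: sum.cong)
    \<comment> \<open>Inclusion-exclusion: the sets counted twice are collected in the second sum,
      which becomes \<open>delta n\<close>.\<close>
    also have "\<dots> = (\<Sum>I\<in>linear_excluding 1 n \<union> linear_excluding 2 l. excluding_weight a n I)
        + (\<Sum>I\<in>linear_excluding 1 n \<inter> linear_excluding 2 l. excluding_weight a n I)"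
      by (simp add: sum.union_inter finite_linear_excluding)
    also have "(\<Sum>I\<in>linear_excluding 1 n \<inter> linear_excluding 2 l. excluding_weight a n I) = delta n"
      unfolding 2 linear_excluding_1_Int_2
      by (simp add: delta_eq excluding_weight_def removed_pairs_def)
    finally show ?thesis
      by (simp only: 2 cyclic_pair_excluding_Suc_Suc)
  qed
  then show ?thesis
    by (simp only: excluding_weight_def)
qed

end
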